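(* For fixed integers $n,d,g$ with $3\leq d\leq n-1$ and $g>0$, there are at least $(d-2)(n-d+1)$ arithmetic progressions with difference $d(n-2)$ of values $e$ such that for some integer $e_0$ with $e\geq e_0\geq (g+1)n$, one has either $$\left\lfloor \frac{-de_0+e}{n-d}\right\rfloor +e =e_0 +\left\lfloor\frac{2e_0+2g-2}{d-2}\right\rfloor$$ or $$\frac{-de_0+e}{n-d} +e =e_0 +\left\lfloor\frac{2e_0+2g-2}{d-2}\right\rfloor+1.$$
   Context: $\lfloor\cdot\rfloor$ denotes the floor function, and $e$ ranges over integers. *)

theory Defs
  imports Complex_Main
begin

definition arith_prog :: "int \<Rightarrow> int \<Rightarrow> int set" where
  "arith_prog a D = {a + int k * D | k::nat. True}"

text \<open>Quotients are taken in the reals, so the second alternative forces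
  \<open>n - d\<close> to divide \<open>e - d * e\<^sub>0\<close>.\<close>

definition good_values :: "int \<Rightarrow> int \<Rightarrow> int \<Rightarrow> int set" where
  "good_values n d g = {e. \<exists>e\<^sub>0::int. e \<ge> e\<^sub>0 \<and> e\<^sub>0 \<ge> (g + 1) * n \<and>
     (\<lfloor>real_of_int (- d * e\<^sub>0 + e) / real_of_int (n - d)\<rfloor> + e
        = e\<^sub>0 + \<lfloor>real_of_int (2 * e\<^sub>0 + 2 * g - 2) / real_of_int (d - 2)\<rfloor>
      \<or> real_of_int (- d * e\<^sub>0 + e) / real_of_int (n - d) + real_of_int e
        = real_of_int (e\<^sub>0 + \<lfloor>real_of_int (2 * e\<^sub>0 + 2 * g - 2) / real_of_int (d - 2)\<rfloor> + 1))}"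

end

(* Write m = n - d, F(x) = floor((2x + 2g - 2)/(d - 2)) and N(x) = n x + m F(x). Clearing
   denominators, e and e0 satisfy the first alternative iff N(e0) <= (m + 1) e < N(e0) + m and
   the second iff (m + 1) e = N(e0) + m. Together these say that (m + 1) e lies among m + 1
   consecutive integers, so every e0 yields exactly one e, namely the ceiling of N(e0)/(m + 1).
   This e is strictly increasing in e0 and grows by d (n - 2) when e0 grows by (d - 2)(m + 1),
   so a window of (d - 2)(m + 1) consecutive e0 yields as many disjoint progressions. *)

theory Submission
  imports Defs
begin

definition threshold :: "int \<Rightarrow> int \<Rightarrow> int \<Rightarrow> int \<Rightarrow> int" where
  "threshold n d g x = n * x + (n - d) * ((2 * x + 2 * g - 2) div (d - 2))"

text \<open>Adding \<open>n - d\<close>, one less than the divisor, makes \<open>div\<close> round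
  up.\<close>

definition e_of :: "int \<Rightarrow> int \<Rightarrow> int \<Rightarrow> int \<Rightarrow> int" where
  "e_of n d g x = (threshold n d g x + (n - d)) div (n - d + 1)"

text \<open>A unit step in the argument raises \<open>threshold\<close> by at least
  \<open>n\<close>, since its floor term is monotone. As \<open>n\<close> exceeds the divisor
  \<open>n - d + 1\<close>, the rounded quotient rises by at least one.\<close>

lemma strict_mono_e_of:
  assumes "3 \<le> d" and "d \<le> n - 1"
  shows "strict_mono (e_of n d g)"
proof (rule strict_monoI)
  fix x y :: int
  assume "x < y"
  define F where "F z = (2 * z + 2 * g - 2) div (d - 2)" for z
  have "F x \<le> F y"
    unfolding F_def using \<open>x < y\<close> assms by (intro zdiv_mono1) auto
  then have "(n - d) * F x \<le> (n - d) * F y"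
    using assms by (intro mult_left_mono) auto
  moreover have "n * (x + 1) \<le> n * y"
    using \<open>x < y\<close> assms by (intro mult_left_mono) auto
  ultimately have "threshold n d g x + (n - d) + (n - d + 1) \<le> threshold n d g y + (n - d)"
    using assms unfolding threshold_def F_def[symmetric] by (simp add: algebra_simps)
  then have "(threshold n d g x + (n - d) + (n - d + 1)) div (n - d + 1) \<le> e_of n d g y"
    unfolding e_of_def using assms by (intro zdiv_mono1) auto
  moreover have "(threshold n d g x + (n - d) + (n - d + 1)) div (n - d + 1) = e_of n d g x + 1"
    unfolding e_of_def using assms by (intro div_add_self2) auto
  ultimately show "e_of n d g x < e_of n d g y"
    by simp
qed

text \<open>For \<open>k = 1\<close> the shift adds exactly \<open>2 * (n - d + 1)\<close> to the
  floor term, so \<open>threshold\<close> grows by \<open>n - d + 1\<close> times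
  \<open>n * (d - 2) + 2 * (n - d) = d * (n - 2)\<close>.\<close>

lemma e_of_add_period:
  assumes "3 \<le> d" and "d \<le> n - 1"
  shows "e_of n d g (x + k * ((d - 2) * (n - d + 1))) = e_of n d g x + k * (d * (n - 2))"
proof -
  have "2 * (x + k * ((d - 2) * (n - d + 1))) + 2 * g - 2
      = (2 * x + 2 * g - 2) + (2 * k * (n - d + 1)) * (d - 2)"
    by algebra
  then have "(2 * (x + k * ((d - 2) * (n - d + 1))) + 2 * g - 2) div (d - 2)
      = 2 * k * (n - d + 1) + (2 * x + 2 * g - 2) div (d - 2)"
    by (simp only:) (rule div_mult_self1, use assms in simp)
  then have "threshold n d g (x + k * ((d - 2) * (n - d + 1)))
      = threshold n d g x + k * (d * (n - 2)) * (n - d + 1)"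
    unfolding threshold_def by algebra
  then have "threshold n d g (x + k * ((d - 2) * (n - d + 1))) + (n - d)
      = (threshold n d g x + (n - d)) + k * (d * (n - 2)) * (n - d + 1)"
    by simp
  then show ?thesis
    unfolding e_of_def
    by (simp only:) (subst div_mult_self1, use assms in simp_all)
qed

lemma e_of_mem_good_values:
  assumes "3 \<le> d" and "d \<le> n - 1" and "g > 0" and x: "(g + 1) * n \<le> x"
  shows "e_of n d g x \<in> good_values n d g"
proof -
  define F where "F = (2 * x + 2 * g - 2) div (d - 2)"
  define m where "m = n - d"
  define e where "e = e_of n d g x"
  \<comment> \<open>This remainder decides between the alternatives: \<open>r = 0\<close> gives the
    second, \<open>r > 0\<close> the first.\<close>
  define r where "r = (threshold n d g x + m) mod (m + 1)"
  have "m \<ge> 1"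
    using assms by (simp add: m_def)
  have r: "0 \<le> r" "r \<le> m"
    using \<open>m \<ge> 1\<close> pos_mod_bound[of "m + 1" "threshold n d g x + m"] by (auto simp: r_def)
  have "e * (m + 1) + r = threshold n d g x + m"
    unfolding e_def e_of_def r_def m_def by (rule div_mult_mod_eq)
  then have eq: "e * (m + 1) + r = n * x + m * F + m"
    by (simp add: threshold_def m_def F_def)
  have "0 \<le> (g + 1) * n"
    using assms by (intro mult_nonneg_nonneg) auto
  with x have "0 \<le> x"
    by simp
  then have "0 \<le> F"
    unfolding F_def using assms by (intro div_int_pos_iff[THEN iffD2]) auto
  \<comment> \<open>Rounding up gives \<open>e * (m + 1)\<close> at least the threshold
    \<open>n * x + m * F\<close>, and \<open>F\<close> is nonnegative; moreover \<open>n\<close> is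
    at least \<open>m + 1\<close> because \<open>d\<close> is positive.\<close>
  have "(m + 1) * x \<le> n * x"
    using \<open>0 \<le> x\<close> assms by (intro mult_right_mono) (auto simp: m_def)
  also have "\<dots> \<le> e * (m + 1)"
    using eq r mult_nonneg_nonneg[of m F] \<open>m \<ge> 1\<close> \<open>0 \<le> F\<close> by linarith
  finally have "x \<le> e"
    using \<open>m \<ge> 1\<close> by (simp add: mult.commute)
  have quot: "- d * x + e = m * (x + F - e + 1) - r"
    using eq unfolding m_def by (simp add: algebra_simps)
  have floorF: "\<lfloor>real_of_int (2 * x + 2 * g - 2) / real_of_int (d - 2)\<rfloor> = F"
    unfolding F_def by (rule floor_divide_of_int_eq)
  have "\<lfloor>real_of_int (- d * x + e) / real_of_int m\<rfloor> + e = x + F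
      \<or> real_of_int (- d * x + e) / real_of_int m + real_of_int e = real_of_int (x + F + 1)"
  proof (cases "r = 0")
    case True
    then have "real_of_int (- d * x + e) = real_of_int m * real_of_int (x + F - e + 1)"
      unfolding quot by (simp only: of_int_mult diff_0_right)
    then have "real_of_int (- d * x + e) / real_of_int m = real_of_int (x + F - e + 1)"
      using \<open>m \<ge> 1\<close> by simp
    then show ?thesis
      by simp
  next
    case False
    \<comment> \<open>Since \<open>r > 0\<close>, the rest \<open>m - r\<close> is a genuine
      remainder below \<open>m\<close>, so the floor drops by one compared with the exact
      case.\<close>
    have "- d * x + e = m * (x + F - e) + (m - r)"
      unfolding quot by (simp add: algebra_simps)
    then have "(- d * x + e) div m = x + F - e"
      by (rule int_div_pos_eq) (use r False in auto)
    then show ?thesis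
      unfolding floor_divide_of_int_eq by simp
  qed
  then show ?thesis
    using x \<open>x \<le> e\<close> unfolding good_values_def e_def[symmetric] m_def
    by (auto simp only: floorF mem_Collect_eq)
qed

theorem theorem1:
  fixes n d g :: int
  assumes "3 \<le> d" and "d \<le> n - 1" and "g > 0"
  shows "\<exists>\<P> :: int set set. finite \<P> \<and>
           int (card \<P>) \<ge> (d - 2) * (n - d + 1) \<and>
           pairwise disjnt \<P> \<and>
           (\<forall>P\<in>\<P>. (\<exists>a. P = arith_prog a (d * (n - 2))) \<and> P \<subseteq> good_values n d g)"
proof -
  define K where "K = (d - 2) * (n - d + 1)"
  define s where "s = (g + 1) * n"
  define A where "A i = arith_prog (e_of n d g i) (d * (n - 2))" for i
  have "K > 0"
    unfolding K_def using assms by (intro mult_pos_pos) auto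
  \<comment> \<open>Each progression is the image under \<open>e_of\<close> of the numbers from
    \<open>i\<close> on that are congruent to \<open>i\<close> mod \<open>K\<close>.\<close>
  have A_eq: "A i = {e_of n d g (i + int k * K) |k. True}" for i
    unfolding A_def arith_prog_def K_def using e_of_add_period[OF assms(1,2)] by simp
  have A_disj: "disjnt (A i) (A j)"
    if i: "i \<in> {s..<s + K}" and j: "j \<in> {s..<s + K}" and "i \<noteq> j" for i j
  proof (rule ccontr)
    assume "\<not> disjnt (A i) (A j)"
    then obtain k l where "e_of n d g (i + int k * K) = e_of n d g (j + int l * K)"
      unfolding A_eq disjnt_iff by blast
    then have "i + int k * K = j + int l * K"
      using strict_mono_eq[OF strict_mono_e_of[OF assms(1,2)]] by blast
    \<comment> \<open>After subtracting \<open>s\<close>, both window offsets lie in [0, K), where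
      reduction mod \<open>K\<close> changes nothing.\<close>
    then have "i - s + int k * K = j - s + int l * K"
      by simp
    then have "(i - s + int k * K) mod K = (j - s + int l * K) mod K"
      by (rule arg_cong)
    then have "(i - s) mod K = (j - s) mod K"
      by (simp only: mod_mult_self1)
    with i j \<open>i \<noteq> j\<close> show False
      by simp
  qed
  \<comment> \<open>Disjointness of \<open>A i\<close> and \<open>A j\<close> excludes
    \<open>A i = A j\<close> once the sets are nonempty; hence the \<open>K\<close> indices give
    \<open>K\<close> different sets.\<close>
  have A_nonempty: "A i \<noteq> {}" for i
    unfolding A_eq by blast
  have inj: "inj_on A {s..<s + K}"
    using A_disj A_nonempty by (metis disjnt_self_iff_empty inj_onI)
  have good: "A i \<subseteq> good_values n d g" if "i \<in> {s..<s + K}" for i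
  proof -
    have "(g + 1) * n \<le> i + int k * K" for k
      using that \<open>K > 0\<close> by (simp add: s_def add_increasing2)
    then show ?thesis
      unfolding A_eq using e_of_mem_good_values[OF assms] by blast
  qed
  show ?thesis
  proof (intro exI[of _ "A ` {s..<s + K}"] conjI ballI)
    show "(d - 2) * (n - d + 1) \<le> int (card (A ` {s..<s + K}))"
      using card_image[OF inj] by (simp add: K_def)
    show "pairwise disjnt (A ` {s..<s + K})"
      unfolding pairwise_def using A_disj by blast
    fix P
    assume "P \<in> A ` {s..<s + K}"
    then obtain i where i: "i \<in> {s..<s + K}" and P: "P = A i"
      by blast
    show "\<exists>a. P = arith_prog a (d * (n - 2))"
      unfolding P A_def by blast
    show "P \<subseteq> good_values n d g"
      unfolding P using i by (rule good)
  qed simp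
qed

end
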